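(* Let $P$ be a parallelogram-free pattern with $|P|\geq 3$. Then for all $n$, \[ S_P^{\nparallel}(n)\leq n^{3/2}+n. \]
   Context: A finite set $A\subseteq\mathbb{C}$ is parallelogram-free if it has no three collinear points and contains no four points that are the vertices of a parallelogram. Sets $A,B$ are similar if $B=zA+w$ for some $z,w\in\mathbb{C}$, $z\neq0$; $S_P(A)$ is the number of subsets of $A$ similar to $P$. For a parallelogram-free pattern $P$, $S_P^{\nparallel}(n)$ is the maximum of $S_P(A)$ over all parallelogram-free sets $A$ with $|A|=n$. *)

theory Defs
  imports "HOL-Analysis.Analysis"
begin

text \<open>The vertices are listed in cyclic order; non-collinearity excludes degenerate parallelograms.\<close>
definition parallelogram :: "complex \<Rightarrow> complex \<Rightarrow> complex \<Rightarrow> complex \<Rightarrow> bool" where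
  "parallelogram a b c d \<longleftrightarrow> b - a = c - d \<and> \<not> collinear {a, b, d}"

definition parallelogram_free :: "complex set \<Rightarrow> bool" where
  "parallelogram_free A \<longleftrightarrow>
     finite A \<and>
     (\<forall>a\<in>A. \<forall>b\<in>A. \<forall>c\<in>A. a \<noteq> b \<and> a \<noteq> c \<and> b \<noteq> c \<longrightarrow> \<not> collinear {a, b, c}) \<and>
     (\<forall>a\<in>A. \<forall>b\<in>A. \<forall>c\<in>A. \<forall>d\<in>A. \<not> parallelogram a b c d)"

definition similar :: "complex set \<Rightarrow> complex set \<Rightarrow> bool" where
  "similar A B \<longleftrightarrow> (\<exists>z w. z \<noteq> 0 \<and> B = (\<lambda>x. z * x + w) ` A)"

definition similar_count :: "complex set \<Rightarrow> complex set \<Rightarrow> nat" where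
  "similar_count P A = card {B. B \<subseteq> A \<and> similar P B}"

text \<open>The set below is finite, as the counts are at most \<open>2 ^ n\<close>, and nonempty, as
  the points \<open>k + k\<^sup>2 \<i>\<close> on a parabola form parallelogram-free sets of every size.\<close>
definition max_similar_count :: "complex set \<Rightarrow> nat \<Rightarrow> nat" where
  "max_similar_count P n = Max {similar_count P A | A. parallelogram_free A \<and> card A = n}"

end

theory Submission
  imports Defs
begin

text \<open>Fix distinct \<open>p, q, r \<in> P\<close> and put \<open>l = (r - p) / (q - p)\<close>. A copy \<open>z P + w \<subseteq> A\<close> is
  determined by the pair \<open>(a, b) = (z p + w, z q + w)\<close>, and \<open>(1 - l) a + l b = z r + w\<close> lies in
  \<open>A\<close>. View these pairs as the edges of a bipartite graph on two copies of \<open>A\<close>. A 4-cycle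
  \<open>a, b, a', b'\<close> would yield four third points that form a parallelogram with sides
  \<open>(1 - l) (a' - a)\<close> and \<open>l (b' - b)\<close>, or three collinear points. So the graph has no 4-cycle, and
  the Kovari--Sos--Turan double count gives \<open>e\<^sup>2 \<le> n (e + n\<^sup>2)\<close> for the number \<open>e\<close> of
  edges.\<close>

text \<open>Counts cherries, that is, ordered pairs of edges with a common end in \<open>A\<close>:
  there are \<open>card E\<close> degenerate ones, and the others are determined by their two ends
  in \<open>B\<close>. Cauchy-Schwarz bounds the cherries from below.\<close>

lemma four_cycle_free_card_square_le:
  fixes A :: "'a set" and B :: "'b set"
  assumes fin: "finite A" "finite B" and E: "E \<subseteq> A \<times> B"
    and free: "\<And>a a' b b'. \<lbrakk>(a, b) \<in> E; (a', b) \<in> E; (a, b') \<in> E; (a', b') \<in> E\<rbrakk> \<Longrightarrow> a = a' \<or> b = b'"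
  shows "(card E)\<^sup>2 \<le> card A * (card E + (card B)\<^sup>2)"
proof -
  define N where "N a = E `` {a}" for a
  have finE: "finite E"
    using E fin by (meson finite_SigmaI finite_subset)
  have finN: "finite (N a)" for a
    unfolding N_def using finE by (simp add: finite_Image)
  have "E = Sigma A N"
    using E by (auto simp: N_def)
  then have cardE: "card E = (\<Sum>a\<in>A. card (N a))"
    using fin finN by (metis card_SigmaI)
  define T where "T = Sigma A (\<lambda>a. N a \<times> N a)"
  define T' where "T' = {t \<in> T. fst (snd t) \<noteq> snd (snd t)}"
  have finT: "finite T"
    unfolding T_def using fin finN by blast
  have cardT: "card T = (\<Sum>a\<in>A. (card (N a))\<^sup>2)"
    unfolding T_def using fin finN by (subst card_SigmaI) (auto simp: card_cartesian_product power2_eq_square)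
  \<comment> \<open>Two vertices of \<open>A\<close> with the same two distinct neighbours in
    \<open>B\<close> would close a 4-cycle.\<close>
  have "inj_on snd T'"
    using free by (auto simp: inj_on_def T'_def T_def N_def)
  then have "card T' = card (snd ` T')"
    by (simp add: card_image)
  also have "\<dots> \<le> card (B \<times> B)"
    using fin E by (intro card_mono) (auto simp: T'_def T_def N_def)
  finally have T': "card T' \<le> (card B)\<^sup>2"
    by (simp add: card_cartesian_product power2_eq_square)
  have "T \<subseteq> (\<lambda>(a, b). (a, b, b)) ` E \<union> T'"
    by (auto simp: T'_def T_def N_def image_iff)
  then have "card T \<le> card ((\<lambda>(a, b). (a, b, b)) ` E \<union> T')"
    using finE finT by (intro card_mono) (auto simp: T'_def)
  also have "\<dots> \<le> card ((\<lambda>(a, b). (a, b, b)) ` E) + card T'"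
    by (rule card_Un_le)
  also have "\<dots> \<le> card E + (card B)\<^sup>2"
    using T' card_image_le[OF finE] by (intro add_mono)
  finally have le: "(\<Sum>a\<in>A. (card (N a))\<^sup>2) \<le> card E + (card B)\<^sup>2"
    using cardT by simp
  have "(\<Sum>a\<in>A. real (card (N a)))\<^sup>2 \<le> (\<Sum>a\<in>A. (real (card (N a)))\<^sup>2) * real (card A)"
    by (rule sum_squared_le_sum_of_squares)
  then have "real ((card E)\<^sup>2) \<le> real ((\<Sum>a\<in>A. (card (N a))\<^sup>2) * card A)"
    by (simp add: cardE)
  then have "(card E)\<^sup>2 \<le> (\<Sum>a\<in>A. (card (N a))\<^sup>2) * card A"
    by (simp only: of_nat_le_iff)
  also have "\<dots> \<le> (card E + (card B)\<^sup>2) * card A"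
    using le by simp
  finally show ?thesis
    by (simp add: mult.commute)
qed

text \<open>The assumption says \<open>e * (e - n) \<le> n ^ 3\<close> over the reals. If the bound
  failed, the factor \<open>e - n\<close> would exceed \<open>n powr (3/2)\<close> and
  \<open>e\<close> would be at least that, so the product would exceed \<open>n ^ 3\<close>.\<close>

lemma le_powr_three_halves_of_square_le:
  fixes e n :: nat
  assumes "e\<^sup>2 \<le> n * (e + n\<^sup>2)"
  shows "real e \<le> real n powr (3/2) + real n"
proof (rule ccontr)
  define s where "s = real n powr (3/2)"
  have s: "s \<ge> 0" "s * s = real n ^ 3"
    by (auto simp: s_def powr_add[symmetric] powr_numeral)
  assume "\<not> real e \<le> real n powr (3/2) + real n"
  then have less: "s < real e - real n" "s \<le> real e"
    by (auto simp: s_def)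
  have "s * s < real e * (real e - real n)"
    using less s by (smt (verit) mult_left_mono mult_strict_right_mono of_nat_0_le_iff)
  moreover have "real (e\<^sup>2) \<le> real (n * (e + n\<^sup>2))"
    using assms by (simp only: of_nat_le_iff)
  ultimately show False
    using s(2) by (simp add: power2_eq_square power3_eq_cube algebra_simps)
qed

lemma parallelogram_free_affine_combinations:
  assumes A: "parallelogram_free A" and l: "l \<noteq> 0" "l \<noteq> 1"
    and mem: "(1 - l) * a + l * b \<in> A" "(1 - l) * a' + l * b \<in> A"
      "(1 - l) * a + l * b' \<in> A" "(1 - l) * a' + l * b' \<in> A"
  shows "a = a' \<or> b = b'"
proof (rule ccontr)
  assume "\<not> (a = a' \<or> b = b')"
  then have ne: "a \<noteq> a'" "b \<noteq> b'" by auto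
  define f where "f x y = (1 - l) * x + l * y" for x y
  have mem: "f a b \<in> A" "f a' b \<in> A" "f a b' \<in> A" "f a' b' \<in> A"
    using mem by (auto simp: f_def)
  have d: "f a b \<noteq> f a' b" "f a b \<noteq> f a b'" "f a' b \<noteq> f a' b'"
    using l ne by (auto simp: f_def)
  have eq: "f a' b - f a b = f a' b' - f a b'"
    by (simp add: f_def)
  have ncol: "\<not> collinear {x, y, z}" if "x \<in> A" "y \<in> A" "z \<in> A" "x \<noteq> y" "x \<noteq> z" "y \<noteq> z" for x y z
    using A that unfolding parallelogram_free_def by blast
  have npar: "\<not> parallelogram x y z w" if "x \<in> A" "y \<in> A" "z \<in> A" "w \<in> A" for x y z w
    using A that unfolding parallelogram_free_def by blast
  \<comment> \<open>Reading the parallelogram from two adjacent vertices forces both diagonals to vanish.\<close>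
  have "collinear {f a b, f a' b, f a b'}"
    using npar[of "f a b" "f a' b" "f a' b'" "f a b'"] mem eq by (simp add: parallelogram_def)
  then have 1: "f a' b = f a b'"
    using ncol mem d by blast
  have "f a b - f a' b = f a b' - f a' b'"
    using eq by (simp add: algebra_simps)
  then have "collinear {f a' b, f a b, f a' b'}"
    using npar[of "f a' b" "f a b" "f a b'" "f a' b'"] mem by (simp add: parallelogram_def)
  then have 2: "f a b = f a' b'"
    using ncol mem d by metis
  \<comment> \<open>With opposite vertices equal, a side equals its own negative.\<close>
  have "2 * (f a' b - f a b) = 0"
    using eq unfolding 1[symmetric] 2[symmetric] by (simp add: algebra_simps)
  then show False
    using d(1) by simp
qed

lemma similar_count_le:
  assumes A: "parallelogram_free A" and P: "card P \<ge> 3"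
  shows "real (similar_count P A) \<le> real (card A) powr (3/2) + real (card A)"
proof -
  obtain p q r where pqr: "{p, q, r} \<subseteq> P" "p \<noteq> q" "p \<noteq> r" "q \<noteq> r"
    using P by (metis card_3_iff obtain_subset_with_card_n)
  define l where "l = (r - p) / (q - p)"
  have l: "l \<noteq> 0" "l \<noteq> 1" "l * (q - p) = r - p"
    using pqr by (auto simp: l_def)
  have finA: "finite A"
    using A by (simp add: parallelogram_free_def)
  define E where "E = {(a, b) \<in> A \<times> A. (1 - l) * a + l * b \<in> A}"
  have EA: "E \<subseteq> A \<times> A"
    by (auto simp: E_def)
  then have finE: "finite E"
    using finA by (meson finite_SigmaI finite_subset)
  \<comment> \<open>The affine map here sends \<open>p\<close> to \<open>a\<close> and
    \<open>q\<close> to \<open>b\<close>. Some edges, such as the diagonal ones, do not decode to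
    similar copies; for an upper bound it suffices that every copy inside \<open>A\<close> is
    hit.\<close>
  define copy where "copy = (\<lambda>(a, b). (\<lambda>x. (b - a) / (q - p) * (x - p) + a) ` P)"
  have "B \<in> copy ` E" if B: "B \<subseteq> A" and sim: "similar P B" for B
  proof -
    obtain z w where zw: "B = (\<lambda>x. z * x + w) ` P"
      using sim by (auto simp: similar_def)
    have "(1 - l) * (z * p + w) + l * (z * q + w) = z * p + w + z * (l * (q - p))"
      by (simp add: algebra_simps)
    also have "\<dots> = z * r + w"
      unfolding l(3) by (simp add: algebra_simps)
    finally have "(z * p + w, z * q + w) \<in> E"
      using B zw pqr(1) by (auto simp: E_def)
    moreover have "(z * q + w - (z * p + w)) / (q - p) = z"
      using pqr(2) by (simp add: field_simps)
    then have "copy (z * p + w, z * q + w) = (\<lambda>x. z * (x - p) + (z * p + w)) ` P"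
      by (simp only: copy_def prod.case)
    then have "copy (z * p + w, z * q + w) = B"
      by (simp add: zw algebra_simps)
    ultimately show ?thesis
      by (metis imageI)
  qed
  then have "similar_count P A \<le> card (copy ` E)"
    unfolding similar_count_def using finE by (intro card_mono) auto
  also have "\<dots> \<le> card E"
    using finE by (rule card_image_le)
  finally have "similar_count P A \<le> card E" .
  moreover have "(card E)\<^sup>2 \<le> card A * (card E + (card A)\<^sup>2)"
  proof (rule four_cycle_free_card_square_le[OF finA finA EA])
    fix a a' b b'
    assume "(a, b) \<in> E" "(a', b) \<in> E" "(a, b') \<in> E" "(a', b') \<in> E"
    then show "a = a' \<or> b = b'"
      using parallelogram_free_affine_combinations[OF A l(1,2)] by (simp add: E_def)
  qed
  then have "real (card E) \<le> real (card A) powr (3/2) + real (card A)"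
    by (rule le_powr_three_halves_of_square_le)
  ultimately show ?thesis
    by linarith
qed

text \<open>Collinearity would make the Vandermonde product of \<open>x\<close>, \<open>y\<close>,
  \<open>z\<close> vanish.\<close>

lemma not_collinear_parabola:
  fixes x y z :: real
  assumes "x \<noteq> y" "x \<noteq> z" "y \<noteq> z"
  shows "\<not> collinear {Complex x (x\<^sup>2), Complex y (y\<^sup>2), Complex z (z\<^sup>2)}"
proof
  assume "collinear {Complex x (x\<^sup>2), Complex y (y\<^sup>2), Complex z (z\<^sup>2)}"
  then obtain u where u: "\<And>v w. \<lbrakk>v \<in> {Complex x (x\<^sup>2), Complex y (y\<^sup>2), Complex z (z\<^sup>2)};
      w \<in> {Complex x (x\<^sup>2), Complex y (y\<^sup>2), Complex z (z\<^sup>2)}\<rbrakk> \<Longrightarrow> \<exists>c. v - w = c *\<^sub>R u"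
    unfolding collinear_def by blast
  obtain c d where "Complex y (y\<^sup>2) - Complex x (x\<^sup>2) = c *\<^sub>R u"
    "Complex z (z\<^sup>2) - Complex x (x\<^sup>2) = d *\<^sub>R u"
    using u by (meson insertCI)
  then have "y - x = c * Re u" "y\<^sup>2 - x\<^sup>2 = c * Im u" "z - x = d * Re u" "z\<^sup>2 - x\<^sup>2 = d * Im u"
    by (auto simp: complex_eq_iff)
  then have "(y - x) * (z\<^sup>2 - x\<^sup>2) = (z - x) * (y\<^sup>2 - x\<^sup>2)"
    by simp
  then have "(y - x) * (z - x) * (z - y) = 0"
    by (simp add: power2_eq_square algebra_simps)
  then show False
    using assms by simp
qed

text \<open>Dividing the difference of squares by the common difference \<open>b - a = c - d\<close>
  gives equal sums as well, hence \<open>a = d\<close>. If that difference is zero, then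
  \<open>a = b\<close>. Either way two of the three points tested for collinearity coincide.\<close>

lemma parallelogram_free_parabola:
  assumes "finite X"
  shows "parallelogram_free ((\<lambda>x. Complex x (x\<^sup>2)) ` X)"
proof -
  have "\<not> parallelogram (Complex a (a\<^sup>2)) (Complex b (b\<^sup>2)) (Complex c (c\<^sup>2)) (Complex d (d\<^sup>2))"
    for a b c d :: real
  proof
    assume par: "parallelogram (Complex a (a\<^sup>2)) (Complex b (b\<^sup>2)) (Complex c (c\<^sup>2)) (Complex d (d\<^sup>2))"
    then have eq: "b - a = c - d" "b\<^sup>2 - a\<^sup>2 = c\<^sup>2 - d\<^sup>2"
      by (auto simp: parallelogram_def complex_eq_iff)
    have "(b - a) * (b + a) = (c - d) * (c + d)"
      using eq(2) by (simp add: power2_eq_square algebra_simps)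
    then have "(b - a) * (b + a) = (b - a) * (c + d)"
      by (simp only: eq(1))
    then have "b = a \<or> d = a"
      using eq(1) by auto
    then show False
      using par by (auto simp: parallelogram_def insert_commute)
  qed
  then show ?thesis
    using assms not_collinear_parabola by (auto simp: parallelogram_free_def)
qed

lemma parallelogram_free_set_exists:
  obtains A where "parallelogram_free A" "card A = n"
proof
  define X where "X = real ` {..<n}"
  show "parallelogram_free ((\<lambda>x. Complex x (x\<^sup>2)) ` X)"
    by (rule parallelogram_free_parabola) (simp add: X_def)
  show "card ((\<lambda>x. Complex x (x\<^sup>2)) ` X) = n"
    by (subst card_image) (auto simp: X_def card_image inj_on_def)
qed

theorem theorem9:
  fixes P :: "complex set" and n :: nat
  assumes "parallelogram_free P" and "card P \<ge> 3"
  shows "real (max_similar_count P n) \<le> real n powr (3/2) + real n"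
proof -
  define S where "S = {similar_count P A | A. parallelogram_free A \<and> card A = n}"
  have bound: "real k \<le> real n powr (3/2) + real n" if "k \<in> S" for k
    using that similar_count_le[OF _ assms(2)] by (auto simp: S_def)
  \<comment> \<open>The uniform bound on the counts also yields the finiteness of
    \<open>S\<close>.\<close>
  have "S \<subseteq> {..nat \<lfloor>real n powr (3/2) + real n\<rfloor>}"
    using bound le_nat_floor by blast
  then have "finite S"
    using finite_subset by blast
  \<comment> \<open>\<open>Max\<close> is a member of its argument only for finite nonempty sets;
    the parabola supplies an element for every \<open>n\<close>.\<close>
  moreover have "S \<noteq> {}"
    using parallelogram_free_set_exists[of n] by (auto simp: S_def)
  ultimately have "Max S \<in> S"
    by (rule Max_in)
  then show ?thesis
    using bound by (simp add: max_similar_count_def S_def)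
qed

end
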